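(* If the point $x_+$ and the step size $a$ are generated by one iteration of the Improved Gradient Method with Memory started at the point $\bar x$, then $$\frac12\|x_+-y\|^2\le\frac12\|\bar x-y\|^2+a\left(f(y)-f(x_+)\right),\qquad y\in\mathbb{E}.$$
   Context: $\mathbb{E}$ is an $n$-dimensional real vector space, $\mathbb{E}^*$ its dual, $\langle s,x\rangle$ the value of $s\in\mathbb{E}^*$ at $x\in\mathbb{E}$ (and $\langle\cdot,\cdot\rangle$ the standard inner product on $\mathbb{R}^{\tilde m}$). $B:\mathbb{E}\to\mathbb{E}^*$ is a symmetric positive definite linear operator, $\|x\|=\sqrt{\langle Bx,x\rangle}$ on $\mathbb{E}$ and $\|g\|_*=\sqrt{\langle g,B^{-1}g\rangle}$ on $\mathbb{E}^*$. $f:\mathbb{E}\to\mathbb{R}$ is convex and differentiable, with gradient Lipschitz continuous with constant $L_f>0$ (i.e. $\|\nabla f(x)-\nabla f(y)\|_*\le L_f\|x-y\|$); $\tau_f=1/L_f$. $\Delta_{\tilde m}$ is the standard simplex in $\mathbb{R}^{\tilde m}$. Algorithm inputs: $L\ge L_f$, $\tau=1/L$, $r_u>1\ge r_d>0$. Model: at the current point $\bar x$ the method has a model of size $\tilde m\ge1$ given by $H\in\mathbb{R}^{\tilde m}$ and $\tilde G=(\tilde G_1,\dots,\tilde G_{\tilde m})$ with $\tilde G_i\in\mathbb{E}^*$ ($\tilde G\lambda=\sum_i\lambda_i\tilde G_i$, $(\tilde G^Ty)_i=\langle\tilde G_i,y\rangle$). Its first record is $\tilde G_1=\nabla f(\bar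 x)$, $H_1=f(\bar x)-\langle\nabla f(\bar x),\bar x\rangle$. Let $Q=\tilde G^TB^{-1}\tilde G$ (the Gram matrix), $\operatorname{diag}(Q)$ its diagonal vector, $(\operatorname{diag}(Q))_i=\|\tilde G_i\|_*^2$. The model is required to satisfy $$f(y)\ge\max_{\lambda\in\Delta_{\tilde m}}\left\{\left\langle H+\tfrac{\tau_f}{2}\operatorname{diag}(Q)+\tilde G^Ty,\lambda\right\rangle-\tfrac{\tau_f}{2}\langle\lambda,Q\lambda\rangle\right\},\quad y\in\mathbb{E}.$$ Let $R=H+\frac{\tau}{2}\operatorname{diag}(Q)+\tilde G^T\bar x$ and $d_{Q,R}(A,\lambda)=\frac{A}{2}\langle\lambda,Q\lambda\rangle-\langle R,\lambda\rangle$. A subprocess, given $A>0$, returns some (approximate, of arbitrary quality) solution $\lambda_{Q,R}(A)\in\Delta_{\tilde m}$ of $\min_{\lambda\in\Delta_{\tilde m}}d_{Q,R}(A,\lambda)$. One iteration: from the previous step size $a_{\mathrm{prev}}>0$ set $a=a_{\mathrm{prev}}/r_d$ and loop: (1) if $a<\tau$, set $a=\tau$, $x_+=\bar x-\tau B^{-1}\nabla f(\bar x)$ and stop; (2) otherwise set $\lambda=\lambda_{Q,R}(a+\tau)$, $x_+=\bar x-aB^{-1}\tilde G\lambda$; if $f(x_+)\le-d_{Q,R}(a+\tau,\lambda)$, stop; (3) otherwise replace $a$ by $a/r_u$ and repeat from (1). The output of the iteration is $(x_+,a)$. *)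

theory Defs
  imports "HOL-Analysis.Analysis"
begin

text \<open>The space E is a type \<open>'a::euclidean_space\<close> and its dual is
  \<open>'a \<Rightarrow>\<^sub>L real\<close>: in finite dimension every linear functional is bounded. The
  library's norms on these types serve only to define differentiability; all metric notions
  of the theorem are taken with respect to the operator \<open>B\<close>. The space of model
  coefficients is \<open>real ^ 'm\<close>, the model size being \<open>CARD('m)\<close>.\<close>

definition sym_pos_def :: "('a::euclidean_space \<Rightarrow> ('a \<Rightarrow>\<^sub>L real)) \<Rightarrow> bool" where
  "sym_pos_def B \<longleftrightarrow> linear B \<and>
     (\<forall>x y. blinfun_apply (B x) y = blinfun_apply (B y) x) \<and>
     (\<forall>x. x \<noteq> 0 \<longrightarrow> blinfun_apply (B x) x > 0)"

definition primal_norm :: "('a::euclidean_space \<Rightarrow> ('a \<Rightarrow>\<^sub>L real)) \<Rightarrow> 'a \<Rightarrow> real" where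
  "primal_norm B x = sqrt (blinfun_apply (B x) x)"

text \<open>A symmetric positive definite \<open>B\<close> is a bijection between E and its dual, so
  \<open>inv B\<close> is its genuine inverse.\<close>

definition dual_norm :: "('a::euclidean_space \<Rightarrow> ('a \<Rightarrow>\<^sub>L real)) \<Rightarrow> ('a \<Rightarrow>\<^sub>L real) \<Rightarrow> real" where
  "dual_norm B g = sqrt (blinfun_apply g (inv B g))"

definition grad :: "('a::euclidean_space \<Rightarrow> real) \<Rightarrow> 'a \<Rightarrow> ('a \<Rightarrow>\<^sub>L real)" where
  "grad f x = Blinfun (frechet_derivative f (at x))"

definition simplex_vecs :: "(real ^ 'm::finite) set" where
  "simplex_vecs = {l. (\<forall>i. 0 \<le> l $ i) \<and> (\<Sum>i\<in>UNIV. l $ i) = 1}"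

definition comb :: "('a::euclidean_space \<Rightarrow>\<^sub>L real) ^ 'm::finite \<Rightarrow> real ^ 'm \<Rightarrow> ('a \<Rightarrow>\<^sub>L real)" where
  "comb G l = (\<Sum>i\<in>UNIV. l $ i *\<^sub>R G $ i)"

definition comb_adj :: "('a::euclidean_space \<Rightarrow>\<^sub>L real) ^ 'm::finite \<Rightarrow> 'a \<Rightarrow> real ^ 'm" where
  "comb_adj G y = (\<chi> i. blinfun_apply (G $ i) y)"

definition gram ::
  "('a::euclidean_space \<Rightarrow> ('a \<Rightarrow>\<^sub>L real)) \<Rightarrow> ('a \<Rightarrow>\<^sub>L real) ^ 'm::finite \<Rightarrow> real ^ 'm ^ 'm" where
  "gram B G = (\<chi> i j. blinfun_apply (G $ i) (inv B (G $ j)))"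

definition diag_vec :: "real ^ 'm ^ 'm::finite \<Rightarrow> real ^ 'm" where
  "diag_vec Q = (\<chi> i. Q $ i $ i)"

text \<open>The supremum is a maximum: the objective is continuous in \<open>l\<close> and the simplex
  is compact and nonempty.\<close>

definition model_max ::
  "('a::euclidean_space \<Rightarrow> ('a \<Rightarrow>\<^sub>L real)) \<Rightarrow> real \<Rightarrow> real ^ 'm::finite \<Rightarrow>
   ('a \<Rightarrow>\<^sub>L real) ^ 'm \<Rightarrow> 'a \<Rightarrow> real" where
  "model_max B t H G y =
     (SUP l\<in>simplex_vecs.
        (H + (t / 2) *\<^sub>R diag_vec (gram B G) + comb_adj G y) \<bullet> l - t / 2 * (l \<bullet> (gram B G *v l)))"

definition dQR :: "real ^ 'm ^ 'm::finite \<Rightarrow> real ^ 'm \<Rightarrow> real \<Rightarrow> real ^ 'm \<Rightarrow> real" where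
  "dQR Q R A l = A / 2 * (l \<bullet> (Q *v l)) - R \<bullet> l"

definition model_R ::
  "('a::euclidean_space \<Rightarrow> ('a \<Rightarrow>\<^sub>L real)) \<Rightarrow> real \<Rightarrow> real ^ 'm::finite \<Rightarrow>
   ('a \<Rightarrow>\<^sub>L real) ^ 'm \<Rightarrow> 'a \<Rightarrow> real ^ 'm" where
  "model_R B t H G xbar = H + (t / 2) *\<^sub>R diag_vec (gram B G) + comb_adj G xbar"

text \<open>\<open>line_search \<dots> a x a'\<close>: the loop, entered at step (1) with current step size
  \<open>a\<close>, stops with output \<open>(x, a')\<close>. The subprocess solving the auxiliary problem for
  the current \<open>Q\<close> and \<open>R\<close> is the function \<open>lam\<close> of \<open>A\<close>; no quality of its
  answers is assumed. A functional dependence on \<open>A\<close> loses nothing, because the calls made in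
  one iteration have strictly decreasing arguments \<open>A\<close>.\<close>

inductive line_search ::
  "('a::euclidean_space \<Rightarrow> real) \<Rightarrow> ('a \<Rightarrow> ('a \<Rightarrow>\<^sub>L real)) \<Rightarrow> real \<Rightarrow> real \<Rightarrow>
   real ^ 'm::finite \<Rightarrow> ('a \<Rightarrow>\<^sub>L real) ^ 'm \<Rightarrow> (real \<Rightarrow> real ^ 'm) \<Rightarrow> 'a \<Rightarrow>
   real \<Rightarrow> 'a \<Rightarrow> real \<Rightarrow> bool"
  for f B t ru H G lam xbar where
  gradient_step:
    "a < t \<Longrightarrow> line_search f B t ru H G lam xbar a (xbar - t *\<^sub>R inv B (grad f xbar)) t"
| accept:
    "\<lbrakk>\<not> a < t; l = lam (a + t); x = xbar - a *\<^sub>R inv B (comb G l);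
      f x \<le> - dQR (gram B G) (model_R B t H G xbar) (a + t) l\<rbrakk>
     \<Longrightarrow> line_search f B t ru H G lam xbar a x a"
| backtrack:
    "\<lbrakk>\<not> a < t; l = lam (a + t); x = xbar - a *\<^sub>R inv B (comb G l);
      \<not> f x \<le> - dQR (gram B G) (model_R B t H G xbar) (a + t) l;
      line_search f B t ru H G lam xbar (a / ru) x' a'\<rbrakk>
     \<Longrightarrow> line_search f B t ru H G lam xbar a x' a'"

definition IGMM_iteration ::
  "('a::euclidean_space \<Rightarrow> real) \<Rightarrow> ('a \<Rightarrow> ('a \<Rightarrow>\<^sub>L real)) \<Rightarrow> real \<Rightarrow> real \<Rightarrow> real \<Rightarrow>
   real ^ 'm::finite \<Rightarrow> ('a \<Rightarrow>\<^sub>L real) ^ 'm \<Rightarrow> (real \<Rightarrow> real ^ 'm) \<Rightarrow> 'a \<Rightarrow>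
   real \<Rightarrow> 'a \<Rightarrow> real \<Rightarrow> bool" where
  "IGMM_iteration f B L ru rd H G lam xbar aprev xplus a \<longleftrightarrow>
     line_search f B (1 / L) ru H G lam xbar (aprev / rd) xplus a"

end

theory Submission
  imports Defs
begin

text \<open>Both stopping rules produce a step \<open>x\<^sub>+ = x - a B\<^sup>-\<^sup>1 g\<close> whose direction satisfies
  \<open>f(y) - f(x\<^sub>+) \<ge> \<langle>g, y - x\<rangle> + a/2 \<parallel>g\<parallel>\<^sub>*\<^sup>2\<close> for all \<open>y\<close>; expanding the square
  \<open>\<parallel>x\<^sub>+ - y\<parallel>\<^sup>2\<close> then gives the claim. For a gradient step the inequality is the sum of the
  gradient inequality and the descent lemma. For an accepted step, evaluate the model's lower bound
  on \<open>f(y)\<close> at the subprocess output \<open>\<lambda>\<close> and subtract the acceptance test; the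
  parameter \<open>1/L\<^sub>f\<close> may be lowered to \<open>1/L\<close> because it multiplies the variance
  \<open>\<langle>diag Q, \<lambda>\<rangle> - \<langle>\<lambda>, Q \<lambda>\<rangle> \<ge> 0\<close>.\<close>

section \<open>Geometry of \<open>B\<close> and of the two norms it induces\<close>

context
  fixes B :: "'a::euclidean_space \<Rightarrow> ('a \<Rightarrow>\<^sub>L real)"
  assumes B: "sym_pos_def B"
begin

lemma linear_B: "linear B" and B_commute: "blinfun_apply (B x) y = blinfun_apply (B y) x"
  and B_nonneg: "0 \<le> blinfun_apply (B x) x"
proof -
  show "linear B" and "blinfun_apply (B x) y = blinfun_apply (B y) x"
    using B by (auto simp: sym_pos_def_def)
  show "0 \<le> blinfun_apply (B x) x"
    using B by (cases "x = 0") (auto simp: sym_pos_def_def less_imp_le)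
qed

text \<open>Definiteness makes \<open>B\<close> injective, and a dimension count gives surjectivity.
  \<open>M\<close> reads the functional \<open>B x\<close> as the vector of its values on
  \<open>Basis\<close>, so the count concerns an endomorphism.\<close>

lemma bij_B: "bij B"
proof -
  have pos: "blinfun_apply (B x) x > 0" if "x \<noteq> 0" for x
    using B that by (simp add: sym_pos_def_def)
  define M :: "'a \<Rightarrow> 'a" where "M x = (\<Sum>b\<in>Basis. blinfun_apply (B x) b *\<^sub>R b)" for x
  have M_inner: "M x \<bullet> b = blinfun_apply (B x) b" if "b \<in> Basis" for x b
    using that by (simp add: M_def)
  have eq: "B x = s" if "\<And>b. b \<in> Basis \<Longrightarrow> M x \<bullet> b = blinfun_apply s b" for x s
    using that M_inner by (intro blinfun_euclidean_eqI) auto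
  have lin: "linear M"
    unfolding M_def
    by (intro linearI)
      (simp_all add: linear_add[OF linear_B] linear_scale[OF linear_B] blinfun.add_left
        blinfun.scaleR_left scaleR_add_left sum.distrib scaleR_sum_right)
  have "x = 0" if "M x = 0" for x
  proof -
    have "B x = 0" using that by (intro eq) auto
    then show ?thesis using pos[of x] by force
  qed
  then have "inj M" by (simp add: linear_injective_0[OF lin])
  then have "surj M" by (simp add: linear_injective_imp_surjective[OF lin])
  have "surj B"
    unfolding surj_def
  proof
    fix s :: "'a \<Rightarrow>\<^sub>L real"
    obtain x where x: "(\<Sum>b\<in>Basis. blinfun_apply s b *\<^sub>R b) = M x"
      using \<open>surj M\<close> by (metis surj_def)
    have "B x = s" by (intro eq) (simp flip: x)
    then show "\<exists>x. s = B x" by blast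
  qed
  moreover have "inj B"
    unfolding linear_injective_0[OF linear_B] using pos by force
  ultimately show ?thesis by (simp add: bij_def)
qed

lemma B_inv [simp]: "B (inv B g) = g" and inv_B [simp]: "inv B (B x) = x"
  using bij_B by (simp_all add: bij_is_surj bij_is_inj surj_f_inv_f)

lemma linear_inv_B: "linear (inv B)"
proof (rule linearI)
  fix g h and c :: real
  show "inv B (g + h) = inv B g + inv B h"
    by (metis B_inv inv_B linear_add[OF linear_B])
  show "inv B (c *\<^sub>R g) = c *\<^sub>R inv B g"
    by (metis B_inv inv_B linear_scale[OF linear_B])
qed

lemma inv_B_commute: "blinfun_apply g (inv B h) = blinfun_apply h (inv B g)"
  by (metis B_commute B_inv)

lemma inv_B_nonneg: "0 \<le> blinfun_apply g (inv B g)"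
  by (metis B_nonneg B_inv)

lemma primal_norm_square: "(primal_norm B x)\<^sup>2 = blinfun_apply (B x) x"
  by (simp add: primal_norm_def B_nonneg)

lemma dual_norm_square: "(dual_norm B g)\<^sup>2 = blinfun_apply g (inv B g)"
  by (simp add: dual_norm_def inv_B_nonneg)

lemma primal_norm_scaleR: "primal_norm B (c *\<^sub>R x) = \<bar>c\<bar> * primal_norm B x"
proof -
  have "blinfun_apply (B (c *\<^sub>R x)) (c *\<^sub>R x) = c\<^sup>2 * blinfun_apply (B x) x"
    by (simp add: linear_scale[OF linear_B] blinfun.scaleR_left blinfun.scaleR_right
        power2_eq_square)
  then show ?thesis by (simp add: primal_norm_def real_sqrt_mult)
qed

lemma primal_norm_step_square:
  "(primal_norm B (x - a *\<^sub>R inv B g - y))\<^sup>2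
    = (primal_norm B (x - y))\<^sup>2 - 2 * a * blinfun_apply g (x - y) + a\<^sup>2 * (dual_norm B g)\<^sup>2"
proof -
  have *: "blinfun_apply (B z) (inv B g) = blinfun_apply g z" for z
    by (metis B_commute B_inv)
  have "(primal_norm B (z - a *\<^sub>R inv B g))\<^sup>2
      = (primal_norm B z)\<^sup>2 - 2 * a * blinfun_apply g z + a\<^sup>2 * (dual_norm B g)\<^sup>2" for z
    by (simp add: primal_norm_square dual_norm_square linear_diff[OF linear_B]
        linear_scale[OF linear_B] blinfun.diff_left blinfun.diff_right blinfun.scaleR_left
        blinfun.scaleR_right * power2_eq_square[of a] algebra_simps)
  from this[of "x - y"] show ?thesis by (simp only: diff_diff_eq add.commute)
qed

text \<open>Young's inequality replaces Cauchy--Schwarz for the pair of dual norms.\<close>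

lemma dual_pairing_le:
  assumes "dual_norm B g \<le> c * primal_norm B x" "c > 0"
  shows "blinfun_apply g x \<le> c * (primal_norm B x)\<^sup>2"
proof -
  \<comment> \<open>With weight \<open>1 / c\<close> the hypothesis bounds the dual term by exactly
    the primal one, \<open>(primal_norm B x)\<^sup>2\<close>.\<close>
  have "0 \<le> (primal_norm B (x - (1 / c) *\<^sub>R inv B g - 0))\<^sup>2" by simp
  then have "2 * (1 / c) * blinfun_apply g x
      \<le> (primal_norm B x)\<^sup>2 + (1 / c)\<^sup>2 * (dual_norm B g)\<^sup>2"
    unfolding primal_norm_step_square by simp
  also have "(1 / c)\<^sup>2 * (dual_norm B g)\<^sup>2 \<le> (1 / c)\<^sup>2 * (c * primal_norm B x)\<^sup>2"
    using assms by (intro mult_left_mono power_mono) (auto simp: dual_norm_def inv_B_nonneg)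
  also have "\<dots> = (primal_norm B x)\<^sup>2" using assms by (simp add: power_mult_distrib power_divide)
  finally show ?thesis using assms by (simp add: field_simps)
qed

text \<open>Through this identity the quadratic forms of the model and of the acceptance test become
  the squared dual norm of the step direction.\<close>

lemma gram_quadratic_form:
  "l \<bullet> (gram B G *v l) = (dual_norm B (comb G l))\<^sup>2"
  by (simp add: dual_norm_square comb_def gram_def inner_vec_def matrix_vector_mult_def
      blinfun.sum_left blinfun.scaleR_left linear_sum[OF linear_inv_B]
      linear_scale[OF linear_inv_B] blinfun.sum_right blinfun.scaleR_right
      sum_distrib_left mult_ac, subst sum.swap, simp add: mult_ac)

text \<open>The difference of the two sides is the variance of the \<open>G $ i\<close> under the
  weights \<open>l\<close>, an average of squared dual norms.\<close>

lemma dual_norm_comb_le: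
  assumes "l \<in> simplex_vecs"
  shows "(dual_norm B (comb G l))\<^sup>2 \<le> diag_vec (gram B G) \<bullet> l"
proof -
  define g where "g = comb G l"
  have sum1: "(\<Sum>i\<in>UNIV. l $ i) = 1" and nonneg: "\<And>i. 0 \<le> l $ i"
    using assms by (auto simp: simplex_vecs_def)
  \<comment> \<open>The weighted mean of the \<open>G $ i\<close> is \<open>g\<close> itself, so the
    cross terms add up to minus twice \<open>(dual_norm B g)\<^sup>2\<close>.\<close>
  have cross: "(\<Sum>i\<in>UNIV. l $ i * blinfun_apply (G $ i) (inv B g)) = (dual_norm B g)\<^sup>2"
    by (simp add: dual_norm_square g_def comb_def blinfun.sum_left blinfun.scaleR_left)
  have "0 \<le> (\<Sum>i\<in>UNIV. l $ i * (dual_norm B (G $ i - g))\<^sup>2)"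
    by (intro sum_nonneg mult_nonneg_nonneg nonneg) auto
  also have "\<dots> = (\<Sum>i\<in>UNIV. l $ i * (dual_norm B (G $ i))\<^sup>2
      - 2 * (l $ i * blinfun_apply (G $ i) (inv B g)) + l $ i * (dual_norm B g)\<^sup>2)"
  proof (intro sum.cong refl)
    fix i
    show "l $ i * (dual_norm B (G $ i - g))\<^sup>2 = l $ i * (dual_norm B (G $ i))\<^sup>2
        - 2 * (l $ i * blinfun_apply (G $ i) (inv B g)) + l $ i * (dual_norm B g)\<^sup>2"
      using inv_B_commute[of g "G $ i"]
      by (simp add: dual_norm_square linear_diff[OF linear_inv_B] blinfun.diff_left
          blinfun.diff_right algebra_simps)
  qed
  also have "\<dots> = (\<Sum>i\<in>UNIV. l $ i * (dual_norm B (G $ i))\<^sup>2) - (dual_norm B g)\<^sup>2"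
    by (simp add: sum.distrib sum_subtractf cross sum1 flip: sum_distrib_left sum_distrib_right)
  finally show ?thesis
    by (simp add: g_def inner_vec_def diag_vec_def gram_def dual_norm_square mult.commute)
qed

text \<open>Multiplied by \<open>a\<close>, the left side of the second hypothesis is exactly the
  cross term plus the quadratic term of half the expanded square.\<close>

lemma prox_inequality:
  assumes "a \<ge> 0"
    and "blinfun_apply g (y - x) + a / 2 * (dual_norm B g)\<^sup>2 \<le> d"
  shows "1 / 2 * (primal_norm B (x - a *\<^sub>R inv B g - y))\<^sup>2
    \<le> 1 / 2 * (primal_norm B (x - y))\<^sup>2 + a * d"
  unfolding primal_norm_step_square using mult_left_mono[OF assms(2,1)]
  by (simp add: blinfun.diff_right power2_eq_square field_simps)

end

section \<open>The simplex and the model's lower bound\<close>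

lemma comb_adj_inner: "comb_adj G y \<bullet> l = blinfun_apply (comb G l) y"
  by (simp add: comb_adj_def comb_def inner_vec_def blinfun.sum_left blinfun.scaleR_left
      mult.commute)

lemma compact_simplex_vecs: "compact (simplex_vecs :: (real ^ 'm::finite) set)"
proof -
  have "simplex_vecs = (\<Inter>i. {l :: real ^ 'm. 0 \<le> l $ i}) \<inter> {l. (\<Sum>i\<in>UNIV. l $ i) = 1}"
    by (auto simp: simplex_vecs_def)
  moreover have "closed \<dots>"
    by (intro closed_Int closed_INT ballI closed_Collect_le closed_Collect_eq continuous_intros)
  moreover have "norm l \<le> 1" if "l \<in> simplex_vecs" for l :: "real ^ 'm"
    using norm_le_l1_cart[of l] that by (simp add: simplex_vecs_def)
  ultimately show ?thesis by (auto simp: compact_eq_bounded_closed bounded_iff)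
qed

text \<open>A real \<open>SUP\<close> dominates its members once the set is bounded above;
  compactness of the simplex and continuity of the objective provide this.\<close>

lemma model_max_upper:
  assumes "l \<in> simplex_vecs"
  shows "(H + (t / 2) *\<^sub>R diag_vec (gram B G) + comb_adj G y) \<bullet> l - t / 2 * (l \<bullet> (gram B G *v l))
    \<le> model_max B t H G y"
  unfolding model_max_def
proof (rule cSUP_upper[OF assms])
  show "bdd_above ((\<lambda>l. (H + (t / 2) *\<^sub>R diag_vec (gram B G) + comb_adj G y) \<bullet> l
      - t / 2 * (l \<bullet> (gram B G *v l))) ` simplex_vecs)"
    by (intro bounded_imp_bdd_above compact_imp_bounded compact_continuous_image
        compact_simplex_vecs continuous_intros matrix_vector_mult_linear_continuous_on)
qed

section \<open>Convex functions with Lipschitz gradient\<close>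

lemma grad_has_derivative:
  assumes "f differentiable (at x)"
  shows "(f has_derivative blinfun_apply (grad f x)) (at x)"
  using assms
  by (simp add: grad_def frechet_derivative_works bounded_linear_Blinfun_apply
      has_derivative_bounded_linear)

lemma grad_line_DERIV:
  assumes "\<forall>x. f differentiable (at x)"
  shows "((\<lambda>s. f (x + s *\<^sub>R h)) has_real_derivative blinfun_apply (grad f (x + s *\<^sub>R h)) h) (at s)"
proof -
  have "((\<lambda>s. x + s *\<^sub>R h) has_derivative (\<lambda>s. s *\<^sub>R h)) (at s)"
    by (auto intro!: derivative_eq_intros)
  from has_derivative_compose[OF this grad_has_derivative[OF assms[rule_format]]]
  show ?thesis
    by (simp add: has_field_derivative_def blinfun.scaleR_right mult.commute[of _ "blinfun_apply _ h"])
qed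

text \<open>Restricted to the line through \<open>x\<close> and \<open>y\<close>, the function lies
  above its tangent at parameter 0.\<close>

lemma convex_gradient_inequality:
  assumes "convex_on UNIV f" "\<forall>x. f differentiable (at x)"
  shows "f x + blinfun_apply (grad f x) (y - x) \<le> f y"
proof -
  define \<phi> where "\<phi> s = f (x + s *\<^sub>R (y - x))" for s
  have "convex_on UNIV \<phi>"
  proof (rule convex_onI)
    fix t u v :: real
    assume "0 < t" "t < 1"
    have "x + ((1 - t) *\<^sub>R u + t *\<^sub>R v) *\<^sub>R (y - x)
        = (1 - t) *\<^sub>R (x + u *\<^sub>R (y - x)) + t *\<^sub>R (x + v *\<^sub>R (y - x))"
      by (simp add: algebra_simps)
    then show "\<phi> ((1 - t) *\<^sub>R u + t *\<^sub>R v) \<le> (1 - t) * \<phi> u + t * \<phi> v"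
      unfolding \<phi>_def using convex_onD[OF assms(1)] \<open>0 < t\<close> \<open>t < 1\<close> by simp
  qed simp
  moreover have "(\<phi> has_real_derivative blinfun_apply (grad f x) (y - x)) (at 0)"
    using grad_line_DERIV[OF assms(2), of x "y - x" 0] by (simp add: \<phi>_def[abs_def])
  ultimately have "\<phi> 1 - \<phi> 0 \<ge> blinfun_apply (grad f x) (y - x) * (1 - 0)"
    by (intro convex_on_imp_above_tangent[where A = UNIV]) auto
  then show ?thesis by (simp add: \<phi>_def)
qed

text \<open>Monotonicity replaces integration: \<open>\<psi>\<close>, the gap between
  \<open>f\<close> along the segment and its quadratic bound up to a constant, has nonpositive
  derivative on [0, 1].\<close>

lemma descent_lemma:
  assumes B: "sym_pos_def B" and diff: "\<forall>x. f differentiable (at x)" and "c > 0"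
    and lip: "\<forall>x y. dual_norm B (grad f x - grad f y) \<le> c * primal_norm B (x - y)"
  shows "f (x + h) \<le> f x + blinfun_apply (grad f x) h + c / 2 * (primal_norm B h)\<^sup>2"
proof -
  define \<psi> where "\<psi> s = f (x + s *\<^sub>R h) - s * blinfun_apply (grad f x) h
      - c / 2 * s\<^sup>2 * (primal_norm B h)\<^sup>2" for s
  have "\<psi> 1 \<le> \<psi> 0"
  proof (rule DERIV_nonpos_imp_nonincreasing[where f = \<psi>])
    fix s :: real
    assume s: "0 \<le> s" "s \<le> 1"
    let ?d = "blinfun_apply (grad f (x + s *\<^sub>R h) - grad f x) h - c * s * (primal_norm B h)\<^sup>2"
    have "(\<psi> has_real_derivative ?d) (at s)"
      unfolding \<psi>_def
      by (auto intro!: derivative_eq_intros grad_line_DERIV[OF diff] simp: blinfun.diff_left)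
    \<comment> \<open>The pairing bound is applied with constant \<open>c * s\<close>, which must be
      positive; at \<open>s = 0\<close> the derivative vanishes.\<close>
    moreover have "?d \<le> 0"
    proof (cases "s = 0")
      case False
      have "dual_norm B (grad f (x + s *\<^sub>R h) - grad f x) \<le> (c * s) * primal_norm B h"
        using lip[rule_format, of "x + s *\<^sub>R h" x] s
        by (simp add: primal_norm_scaleR[OF B] mult.assoc)
      then show ?thesis
        using dual_pairing_le[OF B, of _ "c * s" h] \<open>c > 0\<close> s False by simp
    qed simp
    ultimately show "\<exists>d. (\<psi> has_real_derivative d) (at s) \<and> d \<le> 0" by blast
  qed simp
  then show ?thesis by (simp add: \<psi>_def)
qed

section \<open>Lower bounds on \<open>f y - f xplus\<close> under the two stopping rules\<close>

lemma gradient_step_bound: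
  assumes B: "sym_pos_def B" and convex: "convex_on UNIV f"
    and diff: "\<forall>x. f differentiable (at x)" and "c > 0"
    and lip: "\<forall>x y. dual_norm B (grad f x - grad f y) \<le> c * primal_norm B (x - y)"
    and t: "0 < t" "c * t \<le> 1"
  shows "blinfun_apply (grad f x) (y - x) + t / 2 * (dual_norm B (grad f x))\<^sup>2
    \<le> f y - f (x - t *\<^sub>R inv B (grad f x))"
proof -
  let ?g = "grad f x"
  let ?n = "(dual_norm B ?g)\<^sup>2"
  have "(primal_norm B (- t *\<^sub>R inv B ?g))\<^sup>2 = t\<^sup>2 * ?n"
    unfolding primal_norm_scaleR[OF B] power_mult_distrib
    by (simp add: primal_norm_square[OF B] dual_norm_square[OF B] B_inv[OF B])
  then have "f (x - t *\<^sub>R inv B ?g) \<le> f x - t * ?n + c / 2 * (t\<^sup>2 * ?n)"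
    using descent_lemma[OF B diff \<open>c > 0\<close> lip, of x "- t *\<^sub>R inv B ?g"]
    by (simp add: dual_norm_square[OF B] blinfun.minus_right blinfun.scaleR_right)
  \<comment> \<open>The quadratic term of the descent lemma thus costs at most half of the decrease
    \<open>t * ?n\<close>.\<close>
  moreover have "(c * t) * (t * ?n) \<le> 1 * (t * ?n)"
    using t by (intro mult_right_mono) auto
  ultimately show ?thesis
    using convex_gradient_inequality[OF convex diff, of x y]
    by (simp add: power2_eq_square algebra_simps)
qed

text \<open>On subtraction the \<open>t / 2 * ?D\<close> terms cancel, and the model's
  \<open>- t / 2 * ?n\<close> reduces the coefficient \<open>(a + t) / 2\<close> of the test to
  \<open>a / 2\<close>. Only the value of \<open>f\<close> at \<open>xp\<close> matters
  here.\<close>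

lemma accepted_step_bound:
  assumes B: "sym_pos_def B" and l: "l \<in> simplex_vecs"
    and model: "model_max B t\<^sub>f H G y \<le> f y" and "t \<le> t\<^sub>f"
    and accept: "f xp \<le> - dQR (gram B G) (model_R B t H G x) (a + t) l"
  shows "blinfun_apply (comb G l) (y - x) + a / 2 * (dual_norm B (comb G l))\<^sup>2 \<le> f y - f xp"
proof -
  let ?n = "(dual_norm B (comb G l))\<^sup>2" and ?D = "diag_vec (gram B G) \<bullet> l"
  have "t / 2 * (?D - ?n) \<le> t\<^sub>f / 2 * (?D - ?n)"
    using \<open>t \<le> t\<^sub>f\<close> dual_norm_comb_le[OF B l, of G] by (intro mult_right_mono) auto
  moreover have "H \<bullet> l + t\<^sub>f / 2 * (?D - ?n) + blinfun_apply (comb G l) y \<le> f y"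
    using model_max_upper[OF l, of H t\<^sub>f B G y] model
    by (simp add: gram_quadratic_form[OF B] inner_add_left comb_adj_inner algebra_simps)
  moreover have "f xp \<le> H \<bullet> l + t / 2 * ?D + blinfun_apply (comb G l) x - (a + t) / 2 * ?n"
    using accept
    by (simp add: dQR_def model_R_def gram_quadratic_form[OF B] inner_add_left comb_adj_inner)
  ultimately show ?thesis
    by (simp add: blinfun.diff_right algebra_simps add_divide_distrib)
qed

theorem proposition3p1:
  fixes f :: "'a::euclidean_space \<Rightarrow> real"
    and B :: "'a \<Rightarrow> ('a \<Rightarrow>\<^sub>L real)"
    and L_f L r_u r_d a_prev a :: real
    and H :: "real ^ 'm::finite"
    and G :: "('a \<Rightarrow>\<^sub>L real) ^ 'm"
    and first :: 'm
    and lam :: "real \<Rightarrow> real ^ 'm"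
    and xbar xplus :: 'a
  assumes B: "sym_pos_def B"
    and f_convex: "convex_on UNIV f"
    and f_diff: "\<forall>x. f differentiable (at x)"
    and L_f_pos: "L_f > 0"
    and f_lipschitz: "\<forall>x y. dual_norm B (grad f x - grad f y) \<le> L_f * primal_norm B (x - y)"
    and L: "L \<ge> L_f"
    and r_u: "r_u > 1"
    and r_d: "1 \<ge> r_d" "r_d > 0"
    and G_first: "G $ first = grad f xbar"
    and H_first: "H $ first = f xbar - blinfun_apply (grad f xbar) xbar"
    and model: "\<forall>y. f y \<ge> model_max B (1 / L_f) H G y"
    and subprocess: "\<forall>A>0. lam A \<in> simplex_vecs"
    and a_prev: "a_prev > 0"
    and iteration: "IGMM_iteration f B L r_u r_d H G lam xbar a_prev xplus a"
  shows "\<forall>y. 1 / 2 * (primal_norm B (xplus - y))\<^sup>2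
             \<le> 1 / 2 * (primal_norm B (xbar - y))\<^sup>2 + a * (f y - f xplus)"
proof
  fix y
  define t where "t = 1 / L"
  \<comment> \<open>The second bound serves the descent lemma, the third the lowering of the model
    parameter.\<close>
  have t: "0 < t" "L_f * t \<le> 1" "t \<le> 1 / L_f"
    using L_f_pos L by (auto simp: t_def field_simps)
  have "line_search f B t r_u H G lam xbar (a_prev / r_d) xplus a"
    using iteration by (simp add: IGMM_iteration_def t_def)
  then show "1 / 2 * (primal_norm B (xplus - y))\<^sup>2
      \<le> 1 / 2 * (primal_norm B (xbar - y))\<^sup>2 + a * (f y - f xplus)"
  proof induction
    case (gradient_step b)
    show ?case
      using gradient_step_bound[OF B f_convex f_diff L_f_pos f_lipschitz t(1,2)] t(1)
      by (intro prox_inequality[OF B]) auto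
  next
    case (accept b l x)
    \<comment> \<open>Acceptance requires \<open>t \<le> b\<close>, so the subprocess is called at
      the positive argument \<open>b + t\<close>.\<close>
    have "l \<in> simplex_vecs" using accept subprocess t(1) by simp
    with accept t model show ?case
      unfolding accept(3) by (intro prox_inequality[OF B] accepted_step_bound[OF B]) auto
  \<comment> \<open>The \<open>backtrack\<close> case is its own induction hypothesis, since the
    claim mentions only the output and not the trial step size.\<close>
  qed
qed

end
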